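(* Let $\pi$ be a non-trivial hereditary graph property. If there is a $c$-competitive online algorithm with advice for $\textsc{Max-}\pi$ (without preemption) that reads $b$ bits of advice on inputs of length $n$, then there is a $c$-competitive online algorithm with advice for $\textsc{maxASGk}$ that reads $b+O(\log^2 n)$ bits of advice on inputs of length $n$.
   Context: A graph property is a collection of graphs; it is non-trivial if infinitely many graphs have it and infinitely many graphs do not. It is hereditary if every induced subgraph of a graph with the property also has the property. Online vertex-arrival model: an input is a graph $G$ with vertices $v_1,\dots,v_n$ presented one at a time; when $v_i$ is presented, all edges $\{v_j,v_i\}$ with $j<i$ are revealed. Neither $G$ nor $n$ is known in advance. In $\textsc{Max-}\pi$ (without preemption), upon arrival of each vertex the algorithm irrevocably decides whether to accept it; if $S$ is the set of accepted vertices, the profit is $|S|$ if the induced subgraph $G[S]$ has property $\pi$, and $-\infty$ otherwise. Advice model: the algorithm has access to an infinite binary advice string $\phi$ (chosen with knowledge of the whole input), and its output at step $i$ may depend on $\phi$ and the requests seen so far. For a maximization problem, an algorithm is $c$-competitive with advice complexity $b(n)$ if for every $n$ and every input $I$ of length at most $n$ there exists $\phi$ such that the profit on $I$ with advice $\phi$ is at least $\frac{1}{c}$ times the optimal profit on $I$, and at most the first $b(n)$ bits of $\phi$ are read; $c$ may be a function of $n$. Problem $\textsc{maxASGk}$: the input is a sequence $\perp, x_1,\dots,x_n$ with $x_i\in\{0,1\}$; the algorithm outputs $y_1,\dots,y_n\in\{0,1\}$ where $y_i$ may depend on the advice and on $x_1,\dots,x_{i-1}$. The output is feasible if $x_i\le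 y_i$ for all $i$; the profit is the number of zeros among $y_1,\dots,y_n$ for feasible outputs and $-\infty$ otherwise. *)

theory Defs
  imports
    Complex_Main
    "HOL-Library.Extended_Real"
    "HOL-Library.Landau_Symbols"
    "Graph_Theory.Graph_Theory"
begin

section \<open>Graph properties\<close>

text \<open>
  A finite simple undirected graph is a \<open>pair_graph\<close>: a finite, loop-free pair digraph with
  a symmetric arc relation. Every such graph is isomorphic to one with natural numbers as
  vertices. The graph without vertices counts as a graph.
\<close>

type_synonym ngraph = "nat pair_pre_digraph"

definition isomorphic :: "ngraph \<Rightarrow> ngraph \<Rightarrow> bool" where
  "isomorphic G H \<longleftrightarrow> digraph_iso (with_proj G) (with_proj H)"

definition induced :: "ngraph \<Rightarrow> nat set \<Rightarrow> ngraph" where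
  "induced G S = \<lparr> pverts = S, parcs = {(u, v) \<in> parcs G. u \<in> S \<and> v \<in> S} \<rparr>"

lemma with_proj_induced: "with_proj (induced G S) = with_proj G \<restriction> S"
  by (auto simp: induced_def with_proj_def induce_subgraph_def)

definition graph_property :: "ngraph set \<Rightarrow> bool" where
  "graph_property \<pi> \<longleftrightarrow>
     (\<forall>G\<in>\<pi>. pair_graph G) \<and>
     (\<forall>G\<in>\<pi>. \<forall>H. pair_graph H \<and> isomorphic G H \<longrightarrow> H \<in> \<pi>)"

text \<open>
  Infinitely many graphs means infinitely many isomorphism types; otherwise the
  relabellings of a single graph would already be infinitely many.
\<close>

definition iso_class :: "ngraph \<Rightarrow> ngraph set" where
  "iso_class G = {H. pair_graph H \<and> isomorphic G H}"

definition nontrivial :: "ngraph set \<Rightarrow> bool" where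
  "nontrivial \<pi> \<longleftrightarrow>
     infinite (iso_class ` {G. pair_graph G \<and> G \<in> \<pi>}) \<and>
     infinite (iso_class ` {G. pair_graph G \<and> G \<notin> \<pi>})"

definition hereditary :: "ngraph set \<Rightarrow> bool" where
  "hereditary \<pi> \<longleftrightarrow>
     (\<forall>G\<in>\<pi>. \<forall>H. induced_subgraph (with_proj H) (with_proj G) \<longrightarrow> H \<in> \<pi>)"


section \<open>Online maximization problems with binary answers, and advice\<close>

text \<open>
  An input \<open>I\<close> of length \<open>len P I\<close> calls for that many answers. Answer number \<open>i\<close>
  (counted from 0) is given after the first \<open>i + 1\<close> requests have been revealed. There may
  be a further request at the end to which no answer is given.
\<close>

record ('i, 'r) online_problem =
  inputs :: "'i set"
  len :: "'i \<Rightarrow> nat"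
  requests :: "'i \<Rightarrow> 'r list"
  profit :: "'i \<Rightarrow> bool list \<Rightarrow> ereal"

type_synonym advice = "nat \<Rightarrow> bool"

type_synonym 'r algorithm = "advice \<Rightarrow> 'r list \<Rightarrow> bool"

definition answers ::
  "('i, 'r) online_problem \<Rightarrow> 'r algorithm \<Rightarrow> advice \<Rightarrow> 'i \<Rightarrow> bool list" where
  "answers P A \<phi> I = map (\<lambda>i. A \<phi> (take (Suc i) (requests P I))) [0..<len P I]"

definition opt :: "('i, 'r) online_problem \<Rightarrow> 'i \<Rightarrow> ereal" where
  "opt P I = (SUP ys \<in> {ys. length ys = len P I}. profit P I ys)"

text \<open>
  With advice \<open>\<phi>\<close> on input \<open>I\<close>, only the first \<open>m\<close> advice bits are read: changing
  the remaining bits has no influence on the run.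
\<close>

definition reads_at_most ::
  "('i, 'r) online_problem \<Rightarrow> 'r algorithm \<Rightarrow> advice \<Rightarrow> 'i \<Rightarrow> nat \<Rightarrow> bool" where
  "reads_at_most P A \<phi> I m \<longleftrightarrow>
     (\<forall>\<phi>'. (\<forall>k<m. \<phi>' k = \<phi> k) \<longrightarrow> answers P A \<phi>' I = answers P A \<phi> I)"

definition competitive ::
  "('i, 'r) online_problem \<Rightarrow> 'r algorithm \<Rightarrow> (nat \<Rightarrow> real) \<Rightarrow> (nat \<Rightarrow> nat) \<Rightarrow> bool" where
  "competitive P A c b \<longleftrightarrow>
     (\<forall>n. \<forall>I\<in>inputs P. len P I \<le> n \<longrightarrow>
        (\<exists>\<phi>. ereal (1 / c n) * opt P I \<le> profit P I (answers P A \<phi> I) \<and>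
             reads_at_most P A \<phi> I (b n)))"


section \<open>The two problems\<close>

text \<open>
  The vertices of an input graph with \<open>n\<close> vertices are named \<open>0, \<dots>, n - 1\<close> in order of
  arrival. The request for a vertex is the set of its neighbours among the earlier vertices.
  The answer \<open>True\<close> means that the vertex is accepted.
\<close>

definition max_induced :: "ngraph set \<Rightarrow> (ngraph, nat set) online_problem" where
  "max_induced \<pi> =
     \<lparr> inputs = {G. pair_graph G \<and> (\<exists>n. pverts G = {..<n})},
       len = (\<lambda>G. card (pverts G)),
       requests = (\<lambda>G. map (\<lambda>i. {j. j < i \<and> (j, i) \<in> parcs G}) [0..<card (pverts G)]),
       profit = (\<lambda>G ys. let S = {i. i < length ys \<and> ys ! i} in
                  if induced G S \<in> \<pi> then ereal (real (card S)) else - \<infinity>) \<rparr>"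

text \<open>
  The bit 1 is \<open>True\<close> and the initial request \<open>\<bottom>\<close> is \<open>None\<close>, so the answer \<open>y\<^sub>i\<close> may
  depend on \<open>\<bottom>, x\<^sub>1, \<dots>, x\<^sub>i\<^sub>-\<^sub>1\<close>.
\<close>

definition max_asgk :: "(bool list, bool option) online_problem" where
  "max_asgk =
     \<lparr> inputs = UNIV,
       len = length,
       requests = (\<lambda>xs. None # map Some xs),
       profit = (\<lambda>xs ys.
                  if \<forall>i<length xs. xs ! i \<longrightarrow> ys ! i
                  then ereal (real (card {i. i < length ys \<and> \<not> ys ! i})) else - \<infinity>) \<rparr>"

end

theory Submission
  imports Defs "HOL-Library.Ramsey"
begin

text \<open>
  By Ramsey's theorem, \<open>\<pi>\<close> contains all edgeless graphs or all complete graphs. From the bits \<open>x\<close>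
  build an online graph in which a vertex with bit 0 is joined to all later vertices or to none of
  them, according to that case, so that the zeros induce a graph in \<open>\<pi>\<close>. A vertex with bit 1 is joined
  to later vertices as prescribed by a fixed graph in which every set of \<open>D * (L + 1)\<close> among
  \<open>2 ^ L\<close> vertices induces a given graph \<open>F \<notin> \<pi>\<close>. A set \<open>S\<close> accepted by the algorithm for
  \<open>\<pi>\<close> then contains only \<open>O(log n)\<close> vertices with bit 1. The advice names these vertices, and as many
  rejected zeros to replace them if there are enough, by \<open>O(log n)\<close> bits each.
\<close>

section \<open>Hereditary properties and Ramsey's theorem\<close>

text \<open>Arcs are reflected as well as preserved, so this is embedding as an induced subgraph.
  Working with a bare injection avoids digraph isomorphism records in the combinatorial
  parts.\<close>

definition embeds :: "ngraph \<Rightarrow> ngraph \<Rightarrow> bool" where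
  "embeds H G \<longleftrightarrow> (\<exists>u. inj_on u (pverts H) \<and> u ` pverts H \<subseteq> pverts G \<and>
     (\<forall>x\<in>pverts H. \<forall>y\<in>pverts H. (x, y) \<in> parcs H \<longleftrightarrow> (u x, u y) \<in> parcs G))"

lemma pair_graphI:
  assumes "finite (pverts G)"
    and "\<And>x y. (x, y) \<in> parcs G \<Longrightarrow> x \<in> pverts G \<and> y \<in> pverts G \<and> x \<noteq> y \<and> (y, x) \<in> parcs G"
  shows "pair_graph G"
proof -
  have "parcs G \<subseteq> pverts G \<times> pverts G" using assms(2) by auto
  then have "finite (parcs G)" using assms(1) by (meson finite_SigmaI finite_subset)
  moreover have "sym (parcs G)" using assms(2) by (auto intro: symI)
  ultimately show ?thesis
    using assms by unfold_locales (auto simp: symmetric_def)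
qed

lemma pair_graph_arcD:
  assumes "pair_graph G" and "(x, y) \<in> parcs G"
  shows "x \<in> pverts G" and "y \<in> pverts G" and "x \<noteq> y" and "(y, x) \<in> parcs G"
proof -
  interpret pair_graph G by fact
  show "x \<in> pverts G" "y \<in> pverts G" "x \<noteq> y" "(y, x) \<in> parcs G"
    using assms(2) in_arcsD1 in_arcsD2 no_loops' arcs_symmetric by auto
qed

lemma pair_graph_finite: "pair_graph G \<Longrightarrow> finite (pverts G)"
  by (simp add: pair_graph_def pair_digraph_def pair_fin_digraph_def pair_fin_digraph_axioms_def)

lemma pair_graph_wf: "pair_graph G \<Longrightarrow> wf_digraph (with_proj G)"
  by (simp add: wf_digraph_wp_iff pair_graph_def pair_digraph_def pair_fin_digraph_def)

lemma isomorphic_image: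
  assumes "pair_graph G" and "inj_on u (pverts G)"
    and "pverts H = u ` pverts G" and "parcs H = map_prod u u ` parcs G"
  shows "isomorphic G H"
proof -
  let ?f = "\<lparr> iso_verts = u, iso_arcs = map_prod u u, iso_head = snd, iso_tail = fst \<rparr>"
  have "parcs G \<subseteq> pverts G \<times> pverts G"
    using pair_graph_arcD[OF assms(1)] by auto
  then have "inj_on (map_prod u u) (parcs G)"
    using map_prod_inj_on[OF assms(2,2)] inj_on_subset by blast
  then have "pre_digraph.digraph_isomorphism (with_proj G) ?f"
    using assms(2) pair_graph_wf[OF assms(1)] by (simp add: pre_digraph.digraph_isomorphism_def)
  moreover have "with_proj H = app_iso ?f (with_proj G)"
    by (simp add: with_proj_def app_iso_def assms(3,4))
  ultimately show ?thesis unfolding isomorphic_def digraph_iso_def by blast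
qed

lemma iso_class_cong:
  assumes "pair_graph G" and "isomorphic G H"
  shows "iso_class G = iso_class H"
  using assms digraph_iso_swap[OF pair_graph_wf] digraph_iso_trans
  unfolding iso_class_def isomorphic_def by blast

lemma pair_graph_induced:
  assumes "pair_graph G" and "S \<subseteq> pverts G"
  shows "pair_graph (induced G S)"
  using assms pair_graph_finite[OF assms(1)] pair_graph_arcD[OF assms(1)]
  by (intro pair_graphI) (auto simp: induced_def intro: finite_subset)

lemma hereditary_induced:
  assumes "graph_property \<pi>" and "hereditary \<pi>" and "G \<in> \<pi>" and "S \<subseteq> pverts G"
  shows "induced G S \<in> \<pi>"
proof -
  have G: "pair_graph G" using assms by (simp add: graph_property_def)
  have "induced_subgraph (with_proj (induced G S)) (with_proj G)"
    unfolding induced_subgraph_def subgraph_def compatible_def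
    using assms(4) pair_graph_wf[OF G] pair_graph_wf[OF pair_graph_induced[OF G assms(4)]]
    by (simp add: induced_def split_def)
  with assms show ?thesis by (simp add: hereditary_def)
qed

text \<open>The image of the embedding induces a member of \<pi> by heredity; this member is
  isomorphic to \<open>H\<close>, and \<pi> is closed under isomorphism.\<close>

lemma hereditary_embeds:
  assumes "graph_property \<pi>" and "hereditary \<pi>" and "G \<in> \<pi>" and "pair_graph H" and "embeds H G"
  shows "H \<in> \<pi>"
proof -
  obtain u where u: "inj_on u (pverts H)" "u ` pverts H \<subseteq> pverts G"
    and arcs: "\<And>x y. x \<in> pverts H \<Longrightarrow> y \<in> pverts H \<Longrightarrow> (x, y) \<in> parcs H \<longleftrightarrow> (u x, u y) \<in> parcs G"
    using assms(5) unfolding embeds_def by blast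
  let ?K = "induced G (u ` pverts H)"
  have K: "?K \<in> \<pi>" using hereditary_induced assms u by blast
  have "parcs ?K = map_prod u u ` parcs H"
  proof (intro equalityI subsetI)
    fix e assume "e \<in> parcs ?K"
    then show "e \<in> map_prod u u ` parcs H"
      using arcs by (auto simp: induced_def intro: rev_image_eqI)
  next
    fix e assume "e \<in> map_prod u u ` parcs H"
    then obtain x y where e: "e = (u x, u y)" "(x, y) \<in> parcs H" by auto
    then have "x \<in> pverts H" "y \<in> pverts H" using pair_graph_arcD(1,2)[OF assms(4)] by blast+
    then show "e \<in> parcs ?K" using e arcs by (simp add: induced_def)
  qed
  then have "isomorphic H ?K"
    by (intro isomorphic_image[OF assms(4) u(1)]) (simp_all add: induced_def)
  then have "isomorphic ?K H"
    unfolding isomorphic_def using digraph_iso_swap pair_graph_wf[OF assms(4)] by blast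
  then show ?thesis using K assms(1,4) unfolding graph_property_def by blast
qed

text \<open>Numbering the vertices yields an isomorphic graph on an initial segment of the naturals,
  and there are only finitely many such graphs with at most \<open>m\<close> vertices. Hence
  infinitely many isomorphism types force arbitrarily large graphs.\<close>

lemma finite_iso_classes_bounded:
  "finite (iso_class ` {G. pair_graph G \<and> card (pverts G) \<le> m})"
proof -
  let ?C = "(\<lambda>(k, E). \<lparr> pverts = {..<k}, parcs = E \<rparr> :: ngraph) ` ({..m} \<times> Pow ({..<m} \<times> {..<m}))"
  have "iso_class ` {G. pair_graph G \<and> card (pverts G) \<le> m} \<subseteq> iso_class ` ?C"
  proof clarify
    fix G :: ngraph assume G: "pair_graph G" "card (pverts G) \<le> m"
    let ?k = "card (pverts G)"
    obtain h where h: "bij_betw h (pverts G) {0..<?k}"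
      using ex_bij_betw_finite_nat pair_graph_finite G(1) by blast
    let ?H = "\<lparr> pverts = {..<?k}, parcs = map_prod h h ` parcs G \<rparr>"
    have "isomorphic G ?H"
      using h by (intro isomorphic_image[OF G(1), of h]) (auto simp: bij_betw_def)
    moreover have "h x < m" if "x \<in> pverts G" for x
      using bij_betwE[OF h] that G(2) by fastforce
    then have "map_prod h h ` parcs G \<subseteq> {..<m} \<times> {..<m}"
      using pair_graph_arcD[OF G(1)] by fastforce
    then have "?H \<in> ?C"
      using G(2) by (intro image_eqI[where x = "(?k, map_prod h h ` parcs G)"]) auto
    ultimately show "iso_class G \<in> iso_class ` ?C"
      using iso_class_cong[OF G(1)] by blast
  qed
  moreover have "finite (iso_class ` ?C)" by blast
  ultimately show ?thesis by (rule finite_subset)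
qed

section \<open>Complete and edgeless graphs inside the property\<close>

definition homogeneous :: "bool \<Rightarrow> nat set \<Rightarrow> ngraph" where
  "homogeneous cl V = \<lparr> pverts = V, parcs = {(x, y). x \<in> V \<and> y \<in> V \<and> x \<noteq> y \<and> cl} \<rparr>"

lemma pair_graph_homogeneous: "finite V \<Longrightarrow> pair_graph (homogeneous cl V)"
  by (rule pair_graphI) (auto simp: homogeneous_def)

lemma embeds_homogeneous:
  assumes "finite V" and "finite W" and "card V \<le> card W"
  shows "embeds (homogeneous cl V) (homogeneous cl W)"
proof -
  obtain u where "u ` V \<subseteq> W" "inj_on u V" using card_le_inj[OF assms] by blast
  then show ?thesis
    unfolding embeds_def homogeneous_def by (intro exI[of _ u]) (auto dest: inj_onD)
qed

text \<open>Otherwise some complete graph and some edgeless graph are both outside \<pi>. A member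
  of \<pi> with enough vertices contains, by Ramsey's theorem, a clique or an independent set of the
  corresponding size, and heredity gives a contradiction.\<close>

lemma hereditary_all_homogeneous:
  assumes "graph_property \<pi>" and "hereditary \<pi>" and "nontrivial \<pi>"
  shows "\<exists>cl. \<forall>V. finite V \<longrightarrow> homogeneous cl V \<in> \<pi>"
proof (rule ccontr)
  assume "\<not> ?thesis"
  then have ex: "\<exists>V. finite V \<and> homogeneous cl V \<notin> \<pi>" for cl by simp
  obtain V where V: "finite V" "homogeneous True V \<notin> \<pi>" using ex by blast
  obtain W where W: "finite W" "homogeneous False W \<notin> \<pi>" using ex by blast
  obtain r where r: "\<forall>(X :: nat set) E. finite X \<and> r \<le> card X \<longrightarrow>
      (\<exists>R\<subseteq>X. card R = card V \<and> clique R E \<or> card R = card W \<and> indep R E)"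
    using ramsey2[where 'a = nat and m = "card V" and n = "card W"] by (elim exE conjE) (rule that)
  have "\<not> {G. pair_graph G \<and> G \<in> \<pi>} \<subseteq> {G. pair_graph G \<and> card (pverts G) \<le> r}" (is "\<not> ?A \<subseteq> ?B")
  proof
    assume "?A \<subseteq> ?B"
    then have "iso_class ` ?A \<subseteq> iso_class ` ?B" by (rule image_mono)
    then have "finite (iso_class ` ?A)" using finite_iso_classes_bounded by (rule finite_subset)
    then show False using assms(3) by (simp add: nontrivial_def)
  qed
  then have "\<exists>G. pair_graph G \<and> G \<in> \<pi> \<and> r < card (pverts G)" by (auto simp: not_le)
  then obtain G where G: "pair_graph G" "G \<in> \<pi>" "r \<le> card (pverts G)" using less_imp_le by blast
  let ?E = "(\<lambda>(x, y). {x, y}) ` parcs G"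
  have E: "{x, y} \<in> ?E \<longleftrightarrow> (x, y) \<in> parcs G" for x y
    using pair_graph_arcD[OF G(1)] by (auto simp: doubleton_eq_iff)
  have fin: "finite (pverts G)" using pair_graph_finite[OF G(1)] .
  obtain R where R: "R \<subseteq> pverts G"
    "card R = card V \<and> clique R ?E \<or> card R = card W \<and> indep R ?E"
    using r[rule_format, OF conjI[OF fin G(3)], of ?E] by (elim exE conjE) (rule that)
  have finR: "finite R" using R(1) fin finite_subset by blast
  have ind: "induced G R \<in> \<pi>" using hereditary_induced assms G R by blast
  from R(2) consider (cl) "card R = card V" "clique R ?E" | (ind) "card R = card W" "indep R ?E"
    by blast
  then show False
  proof cases
    case cl
    have "induced G R = homogeneous True R"
      using cl(2) pair_graph_arcD(3)[OF G(1)] R(1)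
      unfolding induced_def homogeneous_def clique_def E by blast
    then show False
      using hereditary_embeds[OF assms(1,2) ind pair_graph_homogeneous[OF V(1)]]
        embeds_homogeneous[OF V(1) finR, of True] cl(1) V(2) by simp
  next
    case ind
    have "induced G R = homogeneous False R"
      using ind(2) pair_graph_arcD(3)[OF G(1)] R(1)
      unfolding induced_def homogeneous_def indep_def E by blast
    then show False
      using hereditary_embeds[OF assms(1,2) \<open>induced G R \<in> \<pi>\<close> pair_graph_homogeneous[OF W(1)]]
        embeds_homogeneous[OF W(1) finR, of False] ind(1) W(2) by simp
  qed
qed


section \<open>Graphs all of whose large subsets induce a given graph\<close>

text \<open>For a uniformly random \<open>X\<close>, the traces on the disjoint sets
  \<open>E i\<close> are independent, and each equals \<open>P i\<close> with probability at least
  \<open>1 / 2 ^ K\<close>. The induction splits \<open>X\<close> into its trace on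
  \<open>E j\<close>, where one value is excluded, and the rest.\<close>

lemma card_avoiding_patterns_le:
  fixes E P :: "'i \<Rightarrow> 'a set"
  assumes "finite I" and "finite U" and "disjoint_family_on E I"
    and "\<And>i. i \<in> I \<Longrightarrow> E i \<subseteq> U" and "\<And>i. i \<in> I \<Longrightarrow> P i \<subseteq> E i" and "\<And>i. i \<in> I \<Longrightarrow> card (E i) \<le> K"
  shows "real (card {X \<in> Pow U. \<forall>i\<in>I. X \<inter> E i \<noteq> P i}) \<le> 2 ^ card U * (1 - 1 / 2 ^ K) ^ card I"
  using assms
proof (induction I arbitrary: U rule: finite_induct)
  case empty
  then show ?case by (simp add: card_Pow[unfolded Pow_def])
next
  case (insert j I)
  let ?A = "{X \<in> Pow U. \<forall>i\<in>insert j I. X \<inter> E i \<noteq> P i}"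
  let ?B = "{Y \<in> Pow (U - E j). \<forall>i\<in>I. Y \<inter> E i \<noteq> P i}"
  have finE: "finite (E j)" using insert.prems(1,3) finite_subset by blast
  have disj: "E i \<inter> E j = {}" if "i \<in> I" for i
  proof -
    have "i \<noteq> j" using insert.hyps(2) that by blast
    then show ?thesis using insert.prems(2) that unfolding disjoint_family_on_def by simp
  qed
  have IH: "real (card ?B) \<le> 2 ^ card (U - E j) * (1 - 1 / 2 ^ K) ^ card I"
  proof (rule insert.IH)
    show "disjoint_family_on E I" by (rule disjoint_family_on_mono[OF _ insert.prems(2)]) blast
    show "E i \<subseteq> U - E j" if "i \<in> I" for i
      using disj[OF that] insert.prems(3)[of i] that by blast
  qed (use insert.prems in auto)
  have inj: "inj_on (\<lambda>X. (X \<inter> E j, X - E j)) ?A"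
    by (rule inj_onI) (metis Int_Diff_Un prod.inject)
  have "(\<lambda>X. (X \<inter> E j, X - E j)) ` ?A \<subseteq> (Pow (E j) - {P j}) \<times> ?B"
  proof (intro image_subsetI)
    fix X assume X: "X \<in> ?A"
    have "(X - E j) \<inter> E i = X \<inter> E i" if "i \<in> I" for i using disj[OF that] by blast
    with X show "(X \<inter> E j, X - E j) \<in> (Pow (E j) - {P j}) \<times> ?B" by auto
  qed
  moreover have "finite ((Pow (E j) - {P j}) \<times> ?B)" using finE insert.prems(1) by simp
  ultimately have "card ?A \<le> card ((Pow (E j) - {P j}) \<times> ?B)"
    by (rule card_inj_on_le[OF inj])
  also have "\<dots> = (2 ^ card (E j) - 1) * card ?B"
    using insert.prems(4) finE by (simp add: card_cartesian_product card_Pow)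
  finally have "real (card ?A) \<le> real (2 ^ card (E j) - 1) * real (card ?B)"
    unfolding of_nat_mult[symmetric] of_nat_le_iff .
  also have "\<dots> \<le> (2 ^ card (E j) - 1) * (2 ^ card (U - E j) * (1 - 1 / 2 ^ K) ^ card I)"
    using IH by (intro mult_mono) (simp_all add: of_nat_diff)
  also have "\<dots> = (2 ^ card U - 2 ^ card (U - E j)) * (1 - 1 / 2 ^ K) ^ card I"
  proof -
    have "card U = card (E j) + card (U - E j)"
      using card_Diff_subset[OF finE, of U] card_mono[OF insert.prems(1), of "E j"] insert.prems(3) by auto
    then show ?thesis by (simp add: power_add algebra_simps)
  qed
  also have "\<dots> \<le> (2 ^ card U * (1 - 1 / 2 ^ K)) * (1 - 1 / 2 ^ K) ^ card I"
  proof (rule mult_right_mono)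
    have "card U \<le> card (U - E j) + K"
      using card_Diff_subset[OF finE, of U] insert.prems(3,5) by fastforce
    then have "(2::real) ^ card U \<le> 2 ^ card (U - E j) * 2 ^ K"
      by (metis one_le_numeral power_add power_increasing)
    then show "(2::real) ^ card U - 2 ^ card (U - E j) \<le> 2 ^ card U * (1 - 1 / 2 ^ K)"
      by (simp add: field_simps)
  qed simp
  finally show ?case using insert.hyps by (simp add: mult.assoc)
qed

text \<open>
  Two points determine at most one of the lines \<open>i \<mapsto> a * i + b\<close>, so these \<open>s\<^sup>2\<close> sets of size
  \<open>k\<close> in a grid of \<open>k * (k * s)\<close> points are pairwise edge-disjoint.
\<close>

definition line_point :: "nat \<Rightarrow> nat \<Rightarrow> nat \<times> nat \<Rightarrow> nat \<Rightarrow> nat" where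
  "line_point k s = (\<lambda>(a, b) i. i * (k * s) + (a * i + b))"

lemma line_height_less:
  assumes "i < k" and "a < s" and "b < s"
  shows "a * i + b < k * (s::nat)"
proof -
  have "a * i + b < a * i + s" using assms by simp
  also have "\<dots> \<le> s * i + s" using assms by simp
  also have "\<dots> = Suc i * s" by simp
  also have "\<dots> \<le> k * s" using assms by (intro mult_le_mono1) simp
  finally show ?thesis .
qed

lemma line_point_less:
  assumes "l \<in> {..<s} \<times> {..<s}" and "i < k"
  shows "line_point k s l i < k * (k * s)"
proof -
  obtain a b where l: "l = (a, b)" "a < s" "b < s" using assms(1) by auto
  have "i * (k * s) + (a * i + b) < Suc i * (k * s)"
    using line_height_less[OF assms(2) l(2,3)] by simp
  also have "\<dots> \<le> k * (k * s)" using assms by (intro mult_le_mono1) simp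
  finally show ?thesis by (simp add: line_point_def l)
qed

text \<open>All heights are below \<open>k * s\<close>, so the grid column is recovered as the
  quotient by \<open>k * s\<close>.\<close>

lemma line_point_eqD:
  assumes "(a, b) \<in> {..<s} \<times> {..<s}" and "(a', b') \<in> {..<s} \<times> {..<s}" and "i < k" and "j < k"
    and "line_point k s (a, b) i = line_point k s (a', b') j"
  shows "i = j \<and> a * i + b = a' * i + b'"
proof -
  have less: "a * i + b < k * s" "a' * j + b' < k * s"
    using assms line_height_less by auto
  have block: "(n * m + r) div m = n" if "r < m" for n m r :: nat using that by simp
  have "line_point k s (a, b) i div (k * s) = i" "line_point k s (a', b') j div (k * s) = j"
    unfolding line_point_def prod.case using less by (auto simp only: block)
  then have "i = j" using assms(5) by simp
  then show ?thesis using assms(5) by (simp add: line_point_def)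
qed

lemma line_point_less_line_point:
  assumes "l \<in> {..<s} \<times> {..<s}" and "l' \<in> {..<s} \<times> {..<s}" and "i < k" and "j < k"
    and "i < j"
  shows "line_point k s l i < line_point k s l' j"
proof -
  obtain a b where l: "l = (a, b)" "a < s" "b < s" using assms(1) by auto
  obtain a' b' where l': "l' = (a', b')" using assms(2) by auto
  have "i * (k * s) + (a * i + b) < Suc i * (k * s)"
    using line_height_less[OF assms(3) l(2,3)] by simp
  also have "\<dots> \<le> j * (k * s)" using assms by (intro mult_le_mono1) simp
  finally show ?thesis by (simp add: line_point_def l l')
qed

text \<open>Subtracting the heights in two different columns determines the slope, and then the
  intercept.\<close>

lemma line_eqI:
  assumes "l \<in> {..<s} \<times> {..<s}" and "l' \<in> {..<s} \<times> {..<s}" and "i < k" and "j < k" and "i < j"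
    and "line_point k s l i = line_point k s l' i" and "line_point k s l j = line_point k s l' j"
  shows "l = l'"
proof -
  obtain a b where l: "l = (a, b)" by (cases l)
  obtain a' b' where l': "l' = (a', b')" by (cases l')
  have i: "a * i + b = a' * i + b'" and j: "a * j + b = a' * j + b'"
    using line_point_eqD assms unfolding l l' by blast+
  obtain d where d: "j = i + d" "d > 0" using assms(5) less_imp_add_positive by blast
  have "a * d = a' * d" using i j unfolding d(1) distrib_left by linarith
  then have "a = a'" using d by simp
  then show ?thesis using i by (simp add: l l')
qed

section \<open>Random graphs and copies of a fixed graph\<close>

text \<open>Members of \<open>X\<close> other than pairs within \<open>T\<close> are ignored. Thus
  one \<open>X\<close> serves all \<open>T\<close> at once, and it may range over the full power set
  of \<open>Pow V\<close>, whose size is easy to count.\<close>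

definition graph_on :: "nat set \<Rightarrow> nat set set \<Rightarrow> ngraph" where
  "graph_on T X = \<lparr> pverts = T, parcs = {(x, y). x \<in> T \<and> y \<in> T \<and> x \<noteq> y \<and> {x, y} \<in> X} \<rparr>"

text \<open>The grid is laid out on \<open>T\<close>, and each of the \<open>s * s\<close> lines is
  a possible place for a copy of \<open>F\<close>. If no copy exists, \<open>X\<close> misses the
  right pattern on every line, and the lines share no pairs.\<close>

lemma card_not_embeds_le:
  assumes "pair_graph F" and "finite V" and "T \<subseteq> V"
    and "card T = card (pverts F) * (card (pverts F) * s)"
  shows "real (card {X \<in> Pow (Pow V). \<not> embeds F (graph_on T X)})
    \<le> 2 ^ card (Pow V) * (1 - 1 / 2 ^ (card (pverts F) * card (pverts F))) ^ (s * s)"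
proof -
  let ?k = "card (pverts F)"
  let ?I = "{..<s} \<times> {..<s}"
  have finT: "finite T" using assms(2,3) finite_subset by blast
  obtain h where h: "bij_betw h {0..<?k} (pverts F)"
    using ex_bij_betw_nat_finite pair_graph_finite[OF assms(1)] by blast
  obtain f where f: "bij_betw f {0..<card T} T"
    using ex_bij_betw_nat_finite finT by blast
  define p where "p l i = f (line_point ?k s l i)" for l i
  have pT: "p l i \<in> T" if "l \<in> ?I" "i < ?k" for l i
    using line_point_less[OF that] f assms(4) unfolding p_def by (auto simp: bij_betw_def)
  have p_eq: "line_point ?k s l i = line_point ?k s l' j"
    if "l \<in> ?I" "l' \<in> ?I" "i < ?k" "j < ?k" "p l i = p l' j" for l l' i j
    using f that line_point_less[OF that(1,3)] line_point_less[OF that(2,4)] assms(4)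
    unfolding p_def bij_betw_def by (auto dest: inj_onD)
  have p_eqD: "i = j" if "l \<in> ?I" "l' \<in> ?I" "i < ?k" "j < ?k" "p l i = p l' j" for l l' i j
    using p_eq[OF that] line_point_less_line_point[OF that(1,2), of i ?k j]
      line_point_less_line_point[OF that(2,1), of j ?k i] that
    by (metis less_irrefl linorder_neqE_nat)
  \<comment> \<open>\<open>E l\<close> holds all pairs of points on line \<open>l\<close>;
    \<open>P l\<close> holds those that must be edges for \<open>l\<close> to carry a copy of
    \<open>F\<close>.\<close>
  define E where "E l = (\<lambda>(i, j). {p l i, p l j}) ` {(i, j). i < j \<and> j < ?k}" for l
  define P where
    "P l = (\<lambda>(i, j). {p l i, p l j}) ` {(i, j). i < j \<and> j < ?k \<and> (h i, h j) \<in> parcs F}" for l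
  have disj: "disjoint_family_on E ?I"
    unfolding disjoint_family_on_def
  proof (intro ballI impI, rule ccontr)
    fix l l' assume l: "l \<in> ?I" "l' \<in> ?I" "l \<noteq> l'" and "E l \<inter> E l' \<noteq> {}"
    then obtain i j i' j' where ij: "i < j" "j < ?k" "i' < j'" "j' < ?k"
      and eq: "{p l i, p l j} = {p l' i', p l' j'}"
      unfolding E_def by auto
    \<comment> \<open>A common pair matches either in order, so that two points determine the line,
      or crosswise, against the order of the columns.\<close>
    from eq consider "p l i = p l' i'" "p l j = p l' j'" | "p l i = p l' j'" "p l j = p l' i'"
      by (auto simp: doubleton_eq_iff)
    then show False
    proof cases
      case 1
      then have "i' = i" "j' = j" using p_eqD[OF l(1,2)] ij by (metis less_trans)+
      then have "l = l'"
        using line_eqI[OF l(1,2), of i ?k j] p_eq[OF l(1,2)] ij 1 by (metis less_trans)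
      then show False using l(3) by simp
    next
      case 2
      then have "i = j'" "j = i'" using p_eqD[OF l(1,2)] ij by (metis less_trans)+
      then show False using ij by simp
    qed
  qed
  have cardE: "card (E l) \<le> ?k * ?k" for l
  proof -
    have "E l \<subseteq> (\<lambda>(i, j). {p l i, p l j}) ` ({..<?k} \<times> {..<?k})"
      unfolding E_def by (intro image_mono) auto
    then have "card (E l) \<le> card ({..<?k} \<times> {..<?k})"
      by (intro surj_card_le) simp_all
    then show ?thesis by (simp add: card_cartesian_product)
  qed
  have embeds: "embeds F (graph_on T X)" if l: "l \<in> ?I" and X: "X \<inter> E l = P l" for X l
  proof -
    define g where "g = inv_into {0..<?k} h"
    have g: "g x < ?k" "h (g x) = x" if "x \<in> pverts F" for x
      using h that inv_into_into[of x h "{0..<?k}"] f_inv_into_f[of x h "{0..<?k}"]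
      unfolding g_def bij_betw_def by auto
    have h_inj: "i = j" if "h i = h j" "i < ?k" "j < ?k" for i j
      using h that unfolding bij_betw_def by (auto dest: inj_onD)
    have arc: "{p l i, p l j} \<in> X \<longleftrightarrow> (h i, h j) \<in> parcs F" if ij: "i < j" "j < ?k" for i j
    proof -
      have "{p l i, p l j} \<in> E l" using ij unfolding E_def by auto
      then have "{p l i, p l j} \<in> X \<longleftrightarrow> {p l i, p l j} \<in> P l" using X by blast
      also have "\<dots> \<longleftrightarrow> (h i, h j) \<in> parcs F"
      proof
        assume "{p l i, p l j} \<in> P l"
        then obtain i' j' where ij': "i' < j'" "j' < ?k" "(h i', h j') \<in> parcs F"
          and eq: "{p l i, p l j} = {p l i', p l j'}" unfolding P_def by auto
        have "{i, j} = {i', j'}"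
          using eq p_eqD[OF l l] ij ij' by (auto simp: doubleton_eq_iff)
        then show "(h i, h j) \<in> parcs F" using ij ij' by (auto simp: doubleton_eq_iff)
      qed (use ij in \<open>auto simp: P_def\<close>)
      finally show ?thesis .
    qed
    have arc': "{p l i, p l j} \<in> X \<longleftrightarrow> (h i, h j) \<in> parcs F" if ij: "i \<noteq> j" "i < ?k" "j < ?k" for i j
    proof (cases "i < j")
      case False
      then have "{p l j, p l i} \<in> X \<longleftrightarrow> (h j, h i) \<in> parcs F" using arc ij by simp
      then show ?thesis using pair_graph_arcD(4)[OF assms(1)] by (auto simp: insert_commute)
    qed (use arc ij in simp)
    show ?thesis
      unfolding embeds_def
    proof (intro exI[of _ "\<lambda>x. p l (g x)"] conjI ballI)
      show inj: "inj_on (\<lambda>x. p l (g x)) (pverts F)"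
        by (rule inj_onI) (metis g p_eqD[OF l l])
      show "(\<lambda>x. p l (g x)) ` pverts F \<subseteq> pverts (graph_on T X)"
        using pT[OF l] g by (auto simp: graph_on_def)
      fix x y assume xy: "x \<in> pverts F" "y \<in> pverts F"
      show "(x, y) \<in> parcs F \<longleftrightarrow> (p l (g x), p l (g y)) \<in> parcs (graph_on T X)"
      proof (cases "x = y")
        case True
        then show ?thesis using pair_graph_arcD(3)[OF assms(1)] by (auto simp: graph_on_def)
      next
        case False
        then have "g x \<noteq> g y" "p l (g x) \<noteq> p l (g y)"
          using g(2)[OF xy(1)] g(2)[OF xy(2)] inj_onD[OF inj] xy by auto
        then show ?thesis
          using arc'[of "g x" "g y"] g xy pT[OF l] by (simp add: graph_on_def)
      qed
    qed
  qed
  have "{X \<in> Pow (Pow V). \<not> embeds F (graph_on T X)}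
      \<subseteq> {X \<in> Pow (Pow V). \<forall>l\<in>?I. X \<inter> E l \<noteq> P l}"
    using embeds by blast
  then have "real (card {X \<in> Pow (Pow V). \<not> embeds F (graph_on T X)})
      \<le> real (card {X \<in> Pow (Pow V). \<forall>l\<in>?I. X \<inter> E l \<noteq> P l})"
    using assms(2) by (intro of_nat_mono card_mono) auto
  also have "\<dots> \<le> 2 ^ card (Pow V) * (1 - 1 / 2 ^ (?k * ?k)) ^ card ?I"
  proof (rule card_avoiding_patterns_le[OF _ _ disj])
    show "E l \<subseteq> Pow V" if "l \<in> ?I" for l
      using pT[OF that] assms(3) unfolding E_def by fastforce
    show "P l \<subseteq> E l" for l unfolding E_def P_def by (rule image_mono) auto
  qed (use assms(2) cardE in auto)
  finally show ?thesis by (simp add: card_cartesian_product)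
qed

lemma embeds_graph_on_mono:
  assumes "embeds F (graph_on T X)" and "T \<subseteq> T'"
  shows "embeds F (graph_on T' X)"
proof -
  obtain u where u: "inj_on u (pverts F)" "u ` pverts F \<subseteq> T"
    "\<And>x y. x \<in> pverts F \<Longrightarrow> y \<in> pverts F \<Longrightarrow> (x, y) \<in> parcs F \<longleftrightarrow> (u x, u y) \<in> parcs (graph_on T X)"
    using assms(1) unfolding embeds_def graph_on_def by auto
  moreover have "(u x, u y) \<in> parcs (graph_on T' X) \<longleftrightarrow> (u x, u y) \<in> parcs (graph_on T X)"
    if "x \<in> pverts F" "y \<in> pverts F" for x y
    using u(2) assms(2) that by (auto simp: graph_on_def)
  ultimately show ?thesis
    using assms(2) unfolding embeds_def by (intro exI[of _ u]) (auto simp: graph_on_def)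
qed

text \<open>With \<open>d = 1 / 2 ^ (k * k)\<close>, the estimates \<open>2 \<le> exp 1\<close> and
  \<open>1 - d \<le> exp (- d)\<close> reduce the claim to \<open>L * k * k * s < d * s * s\<close>.
  The choice of \<open>s\<close> makes \<open>d * s\<close> equal to
  \<open>(k * k + 1) * (L + 1)\<close>, which exceeds \<open>L * k * k\<close>.\<close>

lemma many_lines_suffice:
  fixes k L s :: nat
  assumes "s = (k * k + 1) * 2 ^ (k * k) * (L + 1)"
  shows "real ((2 ^ L) ^ (k * (k * s))) * (1 - 1 / 2 ^ (k * k)) ^ (s * s) < 1"
proof -
  define d where "d = (1 / 2 ^ (k * k) :: real)"
  have d: "0 \<le> d" "d \<le> 1" by (simp_all add: d_def)
  define r where "r = real ((k * k + 1) * (L + 1))"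
  have "s = (k * k + 1) * (L + 1) * 2 ^ (k * k)" unfolding assms by (simp only: mult_ac)
  then have "real s = r * 2 ^ (k * k)" unfolding r_def by (simp only: of_nat_mult of_nat_power of_nat_numeral)
  then have "d * real s = r" by (simp add: d_def)
  then have "real L * real (k * k) < d * real s"
    using add_pos_nonneg[of 1 "real L + real k * real k"] by (simp add: r_def algebra_simps)
  moreover have "0 < s" by (simp add: assms)
  ultimately have lt: "real (L * (k * (k * s))) < d * real (s * s)"
    using mult_strict_right_mono[of "real L * real (k * k)" "d * real s" "real s"]
    by (simp add: mult_ac)
  have "(2::real) \<le> exp 1" using exp_ge_add_one_self[of 1] by simp
  then have "(2::real) ^ (L * (k * (k * s))) \<le> exp 1 ^ (L * (k * (k * s)))"
    by (intro power_mono) simp_all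
  also have "\<dots> = exp (real (L * (k * (k * s))))"
    by (simp add: exp_of_nat_mult[symmetric])
  finally have a: "real ((2 ^ L) ^ (k * (k * s))) \<le> exp (real (L * (k * (k * s))))"
    by (simp add: power_mult)
  have "1 - d \<le> exp (- d)" using exp_ge_add_one_self[of "- d"] by simp
  then have "(1 - d) ^ (s * s) \<le> exp (- d) ^ (s * s)" using d by (intro power_mono) simp_all
  also have "\<dots> = exp (- (d * real (s * s)))"
    by (simp add: exp_of_nat_mult[symmetric] mult.commute)
  finally have "real ((2 ^ L) ^ (k * (k * s))) * (1 - d) ^ (s * s)
      \<le> exp (real (L * (k * (k * s)))) * exp (- (d * real (s * s)))"
    using a d by (intro mult_mono) simp_all
  also have "\<dots> < 1" using lt by (simp add: exp_add[symmetric])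
  finally show ?thesis by (simp add: d_def)
qed

text \<open>Erdos' counting argument: a random graph has this property with positive probability.\<close>

lemma ex_graph_embeds_large_subsets:
  assumes "pair_graph F"
  shows "\<exists>D. \<forall>L. \<exists>X. \<forall>T\<subseteq>{..<2 ^ L}. D * (L + 1) \<le> card T \<longrightarrow> embeds F (graph_on T X)"
proof -
  define k where "k = card (pverts F)"
  \<comment> \<open>The witness for \<open>D\<close> is chosen so that \<open>D * (L + 1)\<close> is
    the grid size \<open>t = k * (k * s)\<close>.\<close>
  show ?thesis
  proof (intro exI[of _ "k * k * ((k * k + 1) * 2 ^ (k * k))"] allI)
    fix L :: nat
    define s where "s = (k * k + 1) * 2 ^ (k * k) * (L + 1)"
    define t where "t = k * (k * s)"
    let ?V = "{..<2 ^ L} :: nat set"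
    let ?T = "{T. T \<subseteq> ?V \<and> card T = t}"
    let ?B = "\<lambda>T. {X \<in> Pow (Pow ?V). \<not> embeds F (graph_on T X)}"
    have "card ?T = 2 ^ L choose t" using n_subsets[of ?V t] by simp
    also have "\<dots> \<le> (2 ^ L) ^ t"
      using binomial_le_pow[of t "2 ^ L"] by (cases "t \<le> 2 ^ L") (simp_all add: binomial_eq_0)
    finally have "card ?T \<le> (2 ^ L) ^ t" .
    then have card_T: "real (card ?T) \<le> real ((2 ^ L) ^ t)" by (rule of_nat_mono)
    \<comment> \<open>Union bound over all \<open>T\<close> of size exactly \<open>t\<close>; larger
      sets are handled at the end by passing to a subset.\<close>
    have "real (card (\<Union>T\<in>?T. ?B T)) \<le> (\<Sum>T\<in>?T. real (card (?B T)))"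
      using card_UN_le[of ?T ?B] by (simp add: of_nat_mono flip: of_nat_sum)
    also have "\<dots> \<le> (\<Sum>T\<in>?T. 2 ^ card (Pow ?V) * (1 - 1 / 2 ^ (k * k)) ^ (s * s))"
      using card_not_embeds_le[OF assms, of ?V _ s]
      by (intro sum_mono) (simp add: k_def t_def)
    also have "\<dots> = 2 ^ card (Pow ?V) * (real (card ?T) * (1 - 1 / 2 ^ (k * k)) ^ (s * s))"
      by simp
    also have "\<dots> \<le> 2 ^ card (Pow ?V) * (real ((2 ^ L) ^ t) * (1 - 1 / 2 ^ (k * k)) ^ (s * s))"
      using card_T by (intro mult_left_mono mult_right_mono) simp_all
    also have "\<dots> < 2 ^ card (Pow ?V) * 1"
      using many_lines_suffice[OF s_def] unfolding t_def by (intro mult_strict_left_mono) simp_all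
    also have "\<dots> = real (card (Pow (Pow ?V)))" by (simp add: card_Pow)
    finally have "card (\<Union>T\<in>?T. ?B T) < card (Pow (Pow ?V))" by simp
    moreover have "finite (\<Union>T\<in>?T. ?B T)"
      by (rule finite_subset[of _ "Pow (Pow ?V)"]) (blast, simp)
    ultimately have "\<not> Pow (Pow ?V) \<subseteq> (\<Union>T\<in>?T. ?B T)"
      using card_mono leD by blast
    then obtain X where X: "\<And>T. T \<subseteq> ?V \<Longrightarrow> card T = t \<Longrightarrow> embeds F (graph_on T X)" by blast
    show "\<exists>X. \<forall>T\<subseteq>?V. k * k * ((k * k + 1) * 2 ^ (k * k)) * (L + 1) \<le> card T \<longrightarrow>
        embeds F (graph_on T X)"
    proof (intro exI allI impI)
      fix T assume T: "T \<subseteq> ?V" "k * k * ((k * k + 1) * 2 ^ (k * k)) * (L + 1) \<le> card T"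
      moreover have "t = k * k * ((k * k + 1) * 2 ^ (k * k)) * (L + 1)"
        by (simp only: t_def s_def mult_ac)
      ultimately have "t \<le> card T" by simp
      then obtain T' where "T' \<subseteq> T" "card T' = t" using obtain_subset_with_card_n by metis
      then show "embeds F (graph_on T X)" using X[of T'] T(1) embeds_graph_on_mono[of F T' X T] by auto
    qed
  qed
qed


section \<open>The reduction\<close>

text \<open>Such a set arises by \<open>m\<close> successive choices of an element of
  \<open>A\<close> or of nothing.\<close>

lemma card_small_subsets_le:
  assumes "finite A"
  shows "card {Q. Q \<subseteq> A \<and> card Q \<le> m} \<le> (card A + 1) ^ m"
proof (induction m)
  case 0
  have "{Q. Q \<subseteq> A \<and> card Q \<le> 0} = {{}}"
    by (auto simp: card_eq_0_iff dest: finite_subset[OF _ assms])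
  then show ?case by simp
next
  case (Suc m)
  let ?F = "\<lambda>m. {Q. Q \<subseteq> A \<and> card Q \<le> m}"
  let ?ins = "\<lambda>(Q, z). case z of None \<Rightarrow> Q | Some x \<Rightarrow> insert x Q"
  let ?Z = "insert None (Some ` A)"
  have fin: "finite (?F m \<times> ?Z)" using assms by simp
  have "?F (Suc m) \<subseteq> ?ins ` (?F m \<times> ?Z)"
  proof
    fix Q assume Q: "Q \<in> ?F (Suc m)"
    show "Q \<in> ?ins ` (?F m \<times> ?Z)"
    proof (cases "Q = {}")
      case True
      then show ?thesis by (intro image_eqI[where x = "({}, None)"]) auto
    next
      case False
      then obtain x where x: "x \<in> Q" by blast
      have "finite Q" using Q assms finite_subset by blast
      then have "card (Q - {x}) \<le> m" using Q x by auto
      then show ?thesis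
        using Q x by (intro image_eqI[where x = "(Q - {x}, Some x)"]) auto
    qed
  qed
  then have "card (?F (Suc m)) \<le> card (?F m \<times> ?Z)"
    by (rule surj_card_le[OF fin])
  also have "\<dots> = card (?F m) * (card A + 1)"
    using assms by (simp add: card_cartesian_product card_image)
  also have "\<dots> \<le> (card A + 1) ^ m * (card A + 1)"
    using Suc by (rule mult_le_mono1)
  finally show ?case by (simp add: mult.commute)
qed

text \<open>Since \<open>2 ^ L + 1 \<le> 2 ^ (L + 1)\<close>, there are enough words of length
  \<open>m * (L + 1)\<close>. The length is the same for all \<open>Q\<close>, so the end of the
  code is known from \<open>L\<close> alone.\<close>

lemma ex_decoder:
  "\<exists>dec. \<forall>Q. Q \<subseteq> {..<2 ^ L} \<longrightarrow> card Q \<le> m \<longrightarrow>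
     (\<exists>w :: bool list. length w = m * (L + 1) \<and> dec w = (Q :: nat set))"
proof -
  let ?F = "{Q :: nat set. Q \<subseteq> {..<2 ^ L} \<and> card Q \<le> m}"
  let ?W = "{w. set w \<subseteq> (UNIV :: bool set) \<and> length w = m * (L + 1)}"
  have "card ?F \<le> (2 ^ L + 1) ^ m"
    using card_small_subsets_le[of "{..<2 ^ L :: nat}" m] by simp
  also have "\<dots> \<le> (2 ^ (L + 1)) ^ m"
    by (intro power_mono) simp_all
  also have "\<dots> = card ?W"
    using card_lists_length_eq[of "UNIV :: bool set" "m * (L + 1)"]
    by (simp only: finite_UNIV card_UNIV_bool power_mult[symmetric] mult.commute)
  finally obtain e where e: "e ` ?F \<subseteq> ?W" "inj_on e ?F"
    using card_le_inj[of ?F ?W] finite_lists_length_eq[of "UNIV :: bool set" "m * (L + 1)"] by auto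
  show ?thesis
  proof (intro exI[of _ "inv_into ?F e"] allI impI)
    fix Q :: "nat set" assume "Q \<subseteq> {..<2 ^ L}" "card Q \<le> m"
    then have "Q \<in> ?F" by blast
    then show "\<exists>w. length w = m * (L + 1) \<and> inv_into ?F e w = Q"
      using e by (intro exI[of _ "e Q"]) auto
  qed
qed

text \<open>\<open>L\<close> is written in unary, which makes the code self-delimiting.\<close>

definition pack :: "nat \<Rightarrow> bool list \<Rightarrow> advice \<Rightarrow> advice" where
  "pack L w \<psi> k =
     (if k \<le> L then k < L else if k < Suc L + length w then w ! (k - Suc L)
      else \<psi> (k - (Suc L + length w)))"

text \<open>Agreement with \<open>pack\<close> is assumed on a finite prefix only, as
  \<open>reads_at_most\<close> quantifies over all advice strings with the same prefix.\<close>

lemma unpack: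
  assumes "\<And>k. k < Suc L + length w + b \<Longrightarrow> \<phi> k = pack L w \<psi> k"
  shows "(LEAST k. \<not> \<phi> k) = L" and "map \<phi> [Suc L..<Suc L + length w] = w"
    and "\<And>k. k < b \<Longrightarrow> \<phi> (Suc L + length w + k) = \<psi> k"
proof -
  show "(LEAST k. \<not> \<phi> k) = L"
  proof (rule Least_equality)
    show "\<not> \<phi> L" using assms[of L] by (simp add: pack_def)
    show "L \<le> k" if "\<not> \<phi> k" for k
      using assms[of k] that by (cases "L \<le> k") (simp_all add: pack_def)
  qed
  show "map \<phi> [Suc L..<Suc L + length w] = w"
  proof (rule nth_equalityI)
    fix i assume "i < length (map \<phi> [Suc L..<Suc L + length w])"
    then have i: "i < length w" by (simp del: upt_Suc)
    have "map \<phi> [Suc L..<Suc L + length w] ! i = \<phi> (Suc L + i)" using i by (simp del: upt_Suc)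
    also have "\<dots> = w ! i" using assms[of "Suc L + i"] i by (simp add: pack_def)
    finally show "map \<phi> [Suc L..<Suc L + length w] ! i = w ! i" .
  qed (simp del: upt_Suc)
  show "\<phi> (Suc L + length w + k) = \<psi> k" if "k < b" for k
    using assms[of "Suc L + length w + k"] that by (simp add: pack_def)
qed

text \<open>
  The edge from \<open>i\<close> to an earlier \<open>j\<close> depends on the bit of \<open>j\<close> only, hence it is known when \<open>i\<close>
  arrives.
\<close>

definition input_graph :: "bool \<Rightarrow> nat set set \<Rightarrow> bool list \<Rightarrow> ngraph" where
  "input_graph cl X xs =
     \<lparr> pverts = {..<length xs},
       parcs = {(i, j). i < length xs \<and> j < length xs \<and> i \<noteq> j \<and>
                 (if xs ! min i j then {i, j} \<in> X else cl)} \<rparr>"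

text \<open>There is one request more than there are bits: the last belongs to the vertex now to be
  decided, whose own bit is still hidden.\<close>

definition known_requests :: "bool \<Rightarrow> nat set set \<Rightarrow> bool list \<Rightarrow> nat set list" where
  "known_requests cl X xs =
     map (\<lambda>i. {j. j < i \<and> (if xs ! j then {j, i} \<in> X else cl)}) [0..<Suc (length xs)]"

lemma take_requests_input_graph:
  assumes "i < length xs"
  shows "take (Suc i) (requests (max_induced \<pi>) (input_graph cl X xs)) = known_requests cl X (take i xs)"
proof -
  have "take (Suc i) [0..<length xs] = [0..<Suc i]" using assms by (simp add: take_upt del: upt_Suc)
  then show ?thesis
    using assms by (auto simp: max_induced_def input_graph_def known_requests_def take_map min_def
        simp del: upt_Suc split: if_splits)
qed

lemma input_graph_in_inputs: "input_graph cl X xs \<in> inputs (max_induced \<pi>)"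
  by (auto simp: max_induced_def input_graph_def min.commute insert_commute intro!: pair_graphI)

lemma len_input_graph: "len (max_induced \<pi>) (input_graph cl X xs) = length xs"
  by (simp add: max_induced_def input_graph_def)

text \<open>
  The answer \<open>False\<close>, a zero, corresponds to accepting the vertex; the decisions of \<open>A\<close> on the
  set \<open>Q\<close> are reversed.
\<close>

definition reduced ::
  "bool \<Rightarrow> (nat \<Rightarrow> nat set set) \<Rightarrow> (nat \<Rightarrow> nat) \<Rightarrow> (nat \<Rightarrow> bool list \<Rightarrow> nat set) \<Rightarrow>
    nat set algorithm \<Rightarrow> bool option algorithm" where
  "reduced cl X l dec A \<phi> rs =
     (let L = (LEAST k. \<not> \<phi> k);
          Q = dec L (map \<phi> [Suc L..<Suc L + l L]);
          \<psi> = (\<lambda>k. \<phi> (Suc L + l L + k));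
          xs = map the (tl rs)
      in A \<psi> (known_requests cl (X L) xs) = (length xs \<in> Q))"

lemma answers_reduced:
  assumes "\<And>k. k < Suc L + length w + b \<Longrightarrow> \<phi> k = pack L w \<psi> k" and "length w = l L"
    and "reads_at_most (max_induced \<pi>) A \<psi> (input_graph cl (X L) xs) b"
  shows "answers max_asgk (reduced cl X l dec A) \<phi> xs =
    map (\<lambda>i. answers (max_induced \<pi>) A \<psi> (input_graph cl (X L) xs) ! i = (i \<in> dec L w)) [0..<length xs]"
proof -
  let ?G = "input_graph cl (X L) xs"
  define \<psi>' where "\<psi>' = (\<lambda>k. \<phi> (Suc L + l L + k))"
  have u: "(LEAST k. \<not> \<phi> k) = L" "map \<phi> [Suc L..<Suc L + l L] = w"
    "\<And>k. k < b \<Longrightarrow> \<phi> (Suc L + l L + k) = \<psi> k"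
    using unpack[where \<phi> = \<phi> and L = L and w = w and b = b and \<psi> = \<psi>] assms(1,2) by simp_all
  \<comment> \<open>\<open>\<psi>'\<close> and \<open>\<psi>\<close> may differ after the first
    \<open>b\<close> bits, which \<open>A\<close> does not read on this input.\<close>
  have eq: "answers (max_induced \<pi>) A \<psi>' ?G = answers (max_induced \<pi>) A \<psi> ?G"
    using assms(3)[unfolded reads_at_most_def, rule_format, of \<psi>'] u(3) by (simp add: \<psi>'_def)
  have "reduced cl X l dec A \<phi> (take (Suc i) (requests max_asgk xs)) =
      (answers (max_induced \<pi>) A \<psi> ?G ! i = (i \<in> dec L w))" if i: "i < length xs" for i
  proof -
    have "map the (tl (take (Suc i) (requests max_asgk xs))) = take i xs"
      by (simp add: max_asgk_def take_map comp_def)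
    then have "reduced cl X l dec A \<phi> (take (Suc i) (requests max_asgk xs)) =
        (A \<psi>' (known_requests cl (X L) (take i xs)) = (i \<in> dec L w))"
      unfolding reduced_def Let_def u(1) u(2) \<psi>'_def using i by simp
    also have "\<dots> = (answers (max_induced \<pi>) A \<psi>' ?G ! i = (i \<in> dec L w))"
      using i by (simp add: answers_def len_input_graph take_requests_input_graph)
    finally show ?thesis by (simp add: eq)
  qed
  then show ?thesis
    by (simp add: answers_def[of max_asgk]) (simp add: max_asgk_def)
qed

section \<open>Correcting the accepted set and comparing optima\<close>

text \<open>\<open>Q\<close> consists of \<open>S - Z\<close>, to be dropped, and of equally many
  elements of \<open>Z - S\<close>, to be added. If \<open>Z - S\<close> is too small, all of it is
  added and the result is \<open>Z\<close> itself.\<close>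

lemma ex_flip_set:
  assumes "finite V" and "S \<subseteq> V" and "Z \<subseteq> V" and "card (S - Z) \<le> m"
  shows "\<exists>Q\<subseteq>V. card Q \<le> 2 * m \<and> (S - Q) \<union> (Q - S) \<subseteq> Z \<and>
    card ((S - Q) \<union> (Q - S)) = min (card S) (card Z)"
proof -
  have fin: "finite S" "finite Z" using assms finite_subset by blast+
  obtain Y where Y: "Y \<subseteq> Z - S" "card Y = min (card (S - Z)) (card (Z - S))"
    using obtain_subset_with_card_n[of "min (card (S - Z)) (card (Z - S))" "Z - S"] by auto
  have finY: "finite Y" using Y(1) fin finite_subset by blast
  let ?Q = "(S - Z) \<union> Y"
  have eq: "(S - ?Q) \<union> (?Q - S) = (S \<inter> Z) \<union> Y" using Y(1) by blast
  have "card ((S \<inter> Z) \<union> Y) = card (S \<inter> Z) + card Y"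
    using Y(1) finY fin by (intro card_Un_disjoint) auto
  moreover have "card S = card (S \<inter> Z) + card (S - Z)" "card Z = card (S \<inter> Z) + card (Z - S)"
    using card_Int_Diff[OF fin(1), of Z] card_Int_Diff[OF fin(2), of S] by (simp_all add: Int_commute)
  ultimately have "card ((S \<inter> Z) \<union> Y) = min (card S) (card Z)" using Y(2) by simp
  moreover have "card ?Q \<le> 2 * m"
    using card_Un_le[of "S - Z" Y] Y(2) assms(4) by simp
  ultimately show ?thesis
    using Y(1) assms(2,3) by (intro exI[of _ ?Q]) (auto simp only: eq)
qed

lemma opt_max_asgk:
  shows "0 \<le> opt max_asgk xs" and "opt max_asgk xs \<le> ereal (real (card {i. i < length xs \<and> \<not> xs ! i}))"
proof -
  have "profit max_asgk xs (replicate (length xs) True) = 0"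
    by (simp add: max_asgk_def)
  moreover have "profit max_asgk xs (replicate (length xs) True) \<le> opt max_asgk xs"
    unfolding opt_def by (rule SUP_upper) (simp add: max_asgk_def)
  ultimately show "0 \<le> opt max_asgk xs" by simp
  show "opt max_asgk xs \<le> ereal (real (card {i. i < length xs \<and> \<not> xs ! i}))"
    unfolding opt_def
  proof (rule SUP_least)
    fix ys :: "bool list" assume "ys \<in> {ys. length ys = len max_asgk xs}"
    then have "length ys = length xs" by (simp add: max_asgk_def)
    moreover have "card {i. i < length xs \<and> \<not> ys ! i} \<le> card {i. i < length xs \<and> \<not> xs ! i}"
      if "\<forall>i<length xs. xs ! i \<longrightarrow> ys ! i"
      using that by (intro card_mono) auto
    ultimately show "profit max_asgk xs ys \<le> ereal (real (card {i. i < length xs \<and> \<not> xs ! i}))"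
      by (simp add: max_asgk_def)
  qed
qed

lemma opt_max_induced_ge:
  assumes "S \<subseteq> pverts G" and "pverts G = {..<n}" and "induced G S \<in> \<pi>"
  shows "ereal (real (card S)) \<le> opt (max_induced \<pi>) G"
proof -
  let ?ys = "map (\<lambda>i. i \<in> S) [0..<n]"
  have "{i. i < length ?ys \<and> ?ys ! i} = S" using assms(1,2) by auto
  then have "profit (max_induced \<pi>) G ?ys = ereal (real (card S))"
    using assms(3) unfolding max_induced_def by (simp only: Let_def if_True online_problem.simps)
  moreover have "profit (max_induced \<pi>) G ?ys \<le> opt (max_induced \<pi>) G"
    unfolding opt_def using assms(2) by (intro SUP_upper) (simp add: max_induced_def)
  ultimately show ?thesis by simp
qed

lemma opt_max_induced_le:
  "opt (max_induced \<pi>) G \<le> ereal (real (card (pverts G)))"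
  unfolding opt_def
proof (rule SUP_least)
  fix ys :: "bool list" assume "ys \<in> {ys. length ys = len (max_induced \<pi>) G}"
  then have "length ys = card (pverts G)" by (simp add: max_induced_def)
  moreover have "card {i. i < length ys \<and> ys ! i} \<le> length ys"
    using card_mono[of "{..<length ys}" "{i. i < length ys \<and> ys ! i}"] by auto
  ultimately show "profit (max_induced \<pi>) G ys \<le> ereal (real (card (pverts G)))"
    by (simp add: max_induced_def Let_def)
qed

text \<open>Here \<open>r\<close> is \<open>1 / c n\<close>, of arbitrary sign, and \<open>g\<close>
  is the graph optimum. For positive \<open>r\<close>, \<open>x \<le> g\<close> gives
  \<open>r * x \<le> s\<close>; and \<open>r * g \<le> s \<le> g\<close> forces
  \<open>r \<le> 1\<close> unless \<open>x = 0\<close>, so \<open>r * x \<le> z\<close>.\<close>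

lemma real_ratio_bound:
  fixes r g z s x :: real
  assumes "0 \<le> x" "x \<le> z" "z \<le> g" "r * g \<le> s" "s \<le> g" "0 \<le> s"
  shows "r * x \<le> min s z"
proof (cases "r \<le> 0")
  case True
  then have "r * x \<le> 0" using assms(1) by (simp add: mult_nonpos_nonneg)
  then show ?thesis using assms by simp
next
  case False
  then have "r * x \<le> r * g" using assms by (intro mult_left_mono) simp_all
  then have "r * x \<le> s" using assms(4) by simp
  moreover have "r * x \<le> x"
  proof (cases "x = 0")
    case False
    then have "g > 0" using assms by simp
    moreover have "r * g \<le> 1 * g" using assms by simp
    ultimately have "r \<le> 1" using mult_le_cancel_right_pos by blast
    then show ?thesis using assms(1) mult_right_mono[of r 1 x] by simp
  qed simp
  ultimately show ?thesis using assms by simp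
qed

section \<open>Size of the additional advice\<close>

definition log_ceil :: "nat \<Rightarrow> nat" where
  "log_ceil n = nat \<lceil>log 2 (real n)\<rceil>"

lemma le_two_pow_log_ceil: "n \<le> 2 ^ log_ceil n"
proof (cases "n = 0")
  case False
  then have "real n = 2 powr log 2 (real n)" by simp
  also have "\<dots> \<le> 2 powr real (log_ceil n)"
    unfolding log_ceil_def by (intro powr_mono) (simp_all add: real_nat_ceiling_ge)
  also have "\<dots> = real (2 ^ log_ceil n)" by (simp add: powr_realpow)
  finally show ?thesis by linarith
qed simp

text \<open>For \<open>n \<ge> 2\<close> the logarithm is at least 1, so
  \<open>log_ceil n + 1\<close> is at most three times the logarithm; squaring gives the 9.\<close>

lemma log_ceil_quadratic_bigo:
  "(\<lambda>n. real (Suc (log_ceil n) + 2 * (D * (log_ceil n + 1)) * (log_ceil n + 1)))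
    \<in> O(\<lambda>n. (log 2 (real n))\<^sup>2)"
proof (rule bigoI[where c = "9 * (1 + 2 * real D)"])
  show "\<forall>\<^sub>F n in sequentially.
    norm (real (Suc (log_ceil n) + 2 * (D * (log_ceil n + 1)) * (log_ceil n + 1)))
      \<le> 9 * (1 + 2 * real D) * norm ((log 2 (real n))\<^sup>2)"
    using eventually_ge_at_top[of 2]
  proof eventually_elim
    case (elim n)
    let ?t = "real (log_ceil n + 1)"
    have l1: "1 \<le> log 2 (real n)" using elim by simp
    have "real (log_ceil n) = of_int \<lceil>log 2 (real n)\<rceil>"
      using l1 unfolding log_ceil_def by simp
    then have "real (log_ceil n) \<le> log 2 (real n) + 1"
      using of_int_ceiling_le_add_one[of "log 2 (real n)"] by simp
    then have t: "1 \<le> ?t" "?t \<le> 3 * log 2 (real n)"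
      using l1 by simp_all
    have "real (Suc (log_ceil n) + 2 * (D * (log_ceil n + 1)) * (log_ceil n + 1)) = ?t + 2 * real D * ?t\<^sup>2"
      by (simp add: power2_eq_square algebra_simps)
    also have "\<dots> \<le> ?t\<^sup>2 + 2 * real D * ?t\<^sup>2" using t(1) by (simp add: self_le_power)
    also have "\<dots> = (1 + 2 * real D) * ?t\<^sup>2" by (simp add: algebra_simps)
    also have "\<dots> \<le> (1 + 2 * real D) * (3 * log 2 (real n))\<^sup>2"
      using t by (intro mult_left_mono power_mono) simp_all
    finally show ?case by (simp add: power_mult_distrib algebra_simps)
  qed
qed

theorem theorem8:
  fixes \<pi> :: "ngraph set" and c :: "nat \<Rightarrow> real" and b :: "nat \<Rightarrow> nat"
  assumes "graph_property \<pi>" and "nontrivial \<pi>" and "hereditary \<pi>"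
    and "\<exists>A. competitive (max_induced \<pi>) A c b"
  shows "\<exists>B g. (\<lambda>n. real (g n)) \<in> O(\<lambda>n. (log 2 (real n))\<^sup>2) \<and>
           competitive max_asgk B c (\<lambda>n. b n + g n)"
proof -
  obtain A where A: "competitive (max_induced \<pi>) A c b" using assms(4) by blast
  obtain cl where cl: "\<And>V. finite V \<Longrightarrow> homogeneous cl V \<in> \<pi>"
    using hereditary_all_homogeneous[OF assms(1,3,2)] by blast
  have "{G. pair_graph G \<and> G \<notin> \<pi>} \<noteq> {}"
    using assms(2) unfolding nontrivial_def by (metis finite.emptyI image_empty)
  then obtain F where F: "pair_graph F" "F \<notin> \<pi>" by blast
  obtain D X where X: "\<And>L T. T \<subseteq> {..<2 ^ L} \<Longrightarrow> D * (L + 1) \<le> card T \<Longrightarrow> embeds F (graph_on T (X L))"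
    using ex_graph_embeds_large_subsets[OF F(1)] by metis
  \<comment> \<open>Twice the bound on \<open>S - Z\<close>: each dropped vertex may come with one
    replacement.\<close>
  define m where "m L = 2 * (D * (L + 1))" for L
  define l where "l L = m L * (L + 1)" for L
  have "\<forall>L. \<exists>d. \<forall>Q. Q \<subseteq> {..<2 ^ L} \<longrightarrow> card Q \<le> m L \<longrightarrow>
      (\<exists>w :: bool list. length w = l L \<and> d w = (Q :: nat set))"
    unfolding l_def by (intro allI ex_decoder)
  from choice[OF this] obtain dec where dec: "\<forall>L Q. Q \<subseteq> {..<2 ^ L} \<longrightarrow> card Q \<le> m L \<longrightarrow>
      (\<exists>w :: bool list. length w = l L \<and> dec L w = (Q :: nat set))"
    by blast
  define B where "B = reduced cl X l dec A"
  \<comment> \<open>\<open>L\<close> in unary with its stop bit takes \<open>Suc L\<close> bits, and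
    the code of \<open>Q\<close> takes \<open>l L\<close>; the advice for \<open>A\<close>
    follows.\<close>
  define g where "g n = Suc (log_ceil n) + l (log_ceil n)" for n
  have "competitive max_asgk B c (\<lambda>n. b n + g n)"
    unfolding competitive_def
  proof (intro allI ballI impI)
    fix n and xs :: "bool list" assume "len max_asgk xs \<le> n"
    then have len: "length xs \<le> n" by (simp add: max_asgk_def)
    \<comment> \<open>The algorithm does not know \<open>n\<close>, but the advice does and supplies
      \<open>L\<close>.\<close>
    define L where "L = log_ceil n"
    define G where "G = input_graph cl (X L) xs"
    have V: "pverts G = {..<length xs}" by (simp add: G_def input_graph_def)
    obtain \<psi> where \<psi>: "ereal (1 / c n) * opt (max_induced \<pi>) G \<le> profit (max_induced \<pi>) G (answers (max_induced \<pi>) A \<psi> G)"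
      "reads_at_most (max_induced \<pi>) A \<psi> G (b n)"
      using A len unfolding competitive_def G_def by (metis input_graph_in_inputs len_input_graph)
    define ys where "ys = answers (max_induced \<pi>) A \<psi> G"
    define S where "S = {i. i < length xs \<and> ys ! i}"
    define Z where "Z = {i. i < length xs \<and> \<not> xs ! i}"
    have len_ys: "length ys = length xs" by (simp add: ys_def answers_def G_def len_input_graph)
    have profit_ys: "profit (max_induced \<pi>) G ys = (if induced G S \<in> \<pi> then ereal (real (card S)) else - \<infinity>)"
      by (simp add: max_induced_def len_ys S_def Let_def)
    \<comment> \<open>Adjacency is governed by the earlier endpoint, which is a zero for every pair
      in \<open>Z\<close>.\<close>
    have "induced G Z = homogeneous cl Z"
      by (auto simp: induced_def homogeneous_def G_def input_graph_def Z_def min_def)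
    then have Z_le: "ereal (real (card Z)) \<le> opt (max_induced \<pi>) G"
      using cl[of Z] by (intro opt_max_induced_ge[OF _ V]) (auto simp: V Z_def)
    obtain r where r: "opt (max_induced \<pi>) G = ereal r"
      using Z_le opt_max_induced_le[of \<pi> G] by (cases "opt (max_induced \<pi>) G") auto
    obtain x where x: "opt max_asgk xs = ereal x"
      using opt_max_asgk[of xs] by (cases "opt max_asgk xs") auto
    \<comment> \<open>The optimum is finite, so the competitive bound excludes a profit of minus
      infinity.\<close>
    have S: "induced G S \<in> \<pi>"
      using \<psi>(1) profit_ys by (auto simp: ys_def[symmetric] r split: if_splits)
    have S_le: "ereal (real (card S)) \<le> opt (max_induced \<pi>) G"
      by (rule opt_max_induced_ge[OF _ V S]) (auto simp: V S_def)
    have ratio: "1 / c n * x \<le> min (real (card S)) (real (card Z))"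
    proof (rule real_ratio_bound)
      show "1 / c n * r \<le> real (card S)" using \<psi>(1) profit_ys S by (simp add: ys_def[symmetric] r)
      show "0 \<le> x" "x \<le> real (card Z)" using opt_max_asgk[of xs] by (simp_all add: x Z_def)
    qed (use Z_le S_le in \<open>simp_all add: r\<close>)
    have xs_L: "{..<length xs} \<subseteq> {..<2 ^ L}"
      using len le_two_pow_log_ceil[of n] unfolding L_def by auto
    \<comment> \<open>The vertices of \<open>S - Z\<close> all have bit 1 and so induce a subgraph
      of the fixed graph given by \<open>X L\<close>. If there were too many of them,
      \<open>F\<close> would embed in \<open>G[S]\<close> and lie in \<pi>.\<close>
    have "card (S - Z) < D * (L + 1)"
    proof (rule ccontr)
      assume "\<not> ?thesis"
      then have "embeds F (graph_on (S - Z) (X L))"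
        using xs_L by (intro X) (auto simp: S_def)
      moreover have "induced G (S - Z) = graph_on (S - Z) (X L)"
        by (auto simp: induced_def graph_on_def G_def input_graph_def S_def Z_def min_def)
      moreover have "induced (induced G S) (S - Z) \<in> \<pi>"
        by (rule hereditary_induced[OF assms(1,3) S]) (auto simp: induced_def)
      moreover have "induced (induced G S) (S - Z) = induced G (S - Z)"
        by (auto simp: induced_def)
      ultimately show False using hereditary_embeds[OF assms(1,3) _ F(1)] F(2) by metis
    qed
    then have W: "card (S - Z) \<le> D * (L + 1)" by (rule less_imp_le)
    have "S \<subseteq> {..<length xs}" "Z \<subseteq> {..<length xs}" by (auto simp: S_def Z_def)
    then have "\<exists>Q\<subseteq>{..<length xs}. card Q \<le> m L \<and> (S - Q) \<union> (Q - S) \<subseteq> Z \<and>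
        card ((S - Q) \<union> (Q - S)) = min (card S) (card Z)"
      unfolding m_def by (rule ex_flip_set[OF finite_lessThan _ _ W])
    then obtain Q where Q: "Q \<subseteq> {..<length xs}" "card Q \<le> m L" "(S - Q) \<union> (Q - S) \<subseteq> Z"
      "card ((S - Q) \<union> (Q - S)) = min (card S) (card Z)"
      by blast
    from dec[rule_format, OF subset_trans[OF Q(1) xs_L] Q(2)]
    obtain w where w: "length w = l L" "dec L w = Q" by (elim exE conjE)
    define zs where "zs = map (\<lambda>i. ys ! i = (i \<in> Q)) [0..<length xs]"
    have run: "answers max_asgk B \<phi> xs = zs" if "\<forall>k < b n + g n. \<phi> k = pack L w \<psi> k" for \<phi>
      unfolding B_def zs_def ys_def G_def w(2)[symmetric]
      using that \<psi>(2) by (intro answers_reduced[where b = "b n"])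
        (simp_all add: w(1) g_def L_def[symmetric] G_def[symmetric])
    \<comment> \<open>Reversing the decisions on \<open>Q\<close> turns the accepted set into the
      symmetric difference of \<open>S\<close> and \<open>Q\<close>, which lies within
      \<open>Z\<close>; this yields feasibility.\<close>
    have flip: "{i. i < length zs \<and> \<not> zs ! i} = (S - Q) \<union> (Q - S)"
      using Q(1) by (auto simp: zs_def S_def)
    have feasible: "\<forall>i<length xs. xs ! i \<longrightarrow> zs ! i"
    proof (intro allI impI, rule ccontr)
      fix i assume i: "i < length xs" "xs ! i" "\<not> zs ! i"
      then have "i \<in> (S - Q) \<union> (Q - S)" unfolding flip[symmetric] by (simp add: zs_def)
      then show False using Q(3) i by (auto simp: Z_def)
    qed
    have "profit max_asgk xs zs = ereal (real (min (card S) (card Z)))"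
      using feasible flip Q(4) by (simp add: max_asgk_def)
    then have "ereal (1 / c n) * opt max_asgk xs \<le> profit max_asgk xs zs"
      using ratio by (auto simp: x min_def split: if_splits)
    then show "\<exists>\<phi>. ereal (1 / c n) * opt max_asgk xs \<le> profit max_asgk xs (answers max_asgk B \<phi> xs) \<and>
        reads_at_most max_asgk B \<phi> xs (b n + g n)"
      \<comment> \<open>\<open>run\<close> holds for every advice with the same first
        \<open>b n + g n\<close> bits, so it gives both the profit and the bound on the bits
        read.\<close>
      using run by (intro exI[of _ "pack L w \<psi>"]) (simp add: reads_at_most_def)
  qed
  moreover have "(\<lambda>n. real (g n)) \<in> O(\<lambda>n. (log 2 (real n))\<^sup>2)"
    using log_ceil_quadratic_bigo[of D] by (simp only: g_def l_def m_def)
  ultimately show ?thesis by blast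
qed

end
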